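(* Let $D\ge 1$, $\mathcal X=\{0,1\}^D$, let $G=(\mathcal S,\mathcal A)$ be the DAG on $\mathcal S=\{0,1,\oslash\}^D$ described in the context, let $\mathcal E:\mathcal X\to\mathbb R$ be an energy function, and let $R(\mathbf x)=e^{-\mathcal E(\mathbf x)}$. Let $F$ be a Markovian flow on $G$ with forward policy $P_F$ and backward policy $P_B$, and suppose that the reward matching condition holds: for every $\mathbf x\in\mathcal X$, $$R(\mathbf x)=\sum_{\tau=(\mathbf s_0\to\cdots\to\mathbf s_D),\ \mathbf s_D=\mathbf x}F(\tau),$$ the sum being over complete trajectories ending in $\mathbf x$. Let $1\le K\le D$, let $\mathbf x,\mathbf x'\in\mathcal X$, and let $(\tau,\tau')$ be a $K$-step back-and-forth trajectory from $\mathbf x$ to $\mathbf x'$ that has positive proposal probability, i.e. $P_B(\tau\mid\mathbf x)P_F(\tau')>0$. Then the Metropolis–Hastings acceptance probability satisfies $$A_{\tau,\tau'}(\mathbf x\to\mathbf x')=1,$$ so the Metropolis–Hastings rejection step always accepts the proposal.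
   Context: **The DAG.** The state space is $\mathcal S=\{0,1,\oslash\}^D$, where $\oslash$ denotes an unspecified entry. The edges (actions) in $\mathcal A$ are the pairs $\mathbf s\to\mathbf s'$ where $\mathbf s'$ is obtained from $\mathbf s$ by changing exactly one entry from $\oslash$ to $0$ or $1$; then $\mathbf s'$ is a child of $\mathbf s$ and $\mathbf s$ is a parent of $\mathbf s'$. The initial state is $\mathbf s_0=(\oslash,\dots,\oslash)$ and the terminal states (those with no children) are exactly the elements of $\mathcal X=\{0,1\}^D$. A complete trajectory is a directed path $\mathbf s_0\to\mathbf s_1\to\cdots\to\mathbf s_D$ from $\mathbf s_0$ to a terminal state (it always has exactly $D$ edges); $\mathcal T$ is the set of complete trajectories. **Flows and policies.** A trajectory flow is a function $F:\mathcal T\to\mathbb R_{\ge0}$. It is Markovian if there are a constant $Z>0$ and probability distributions $P_F(\cdot\mid\mathbf s)$ over the children of each non-terminal state $\mathbf s$ (the forward policy) such that for every complete trajectory $\tau=(\mathbf s_0\to\cdots\to\mathbf s_D)$, $F(\tau)/Z=\prod_{t=0}^{D-1}P_F(\mathbf s_{t+1}\mid\mathbf s_t)$. The state flow is $F(\mathbf s)=\sum_{\tau\ni\mathbf s}F(\tau)$ and the edge flow $F(\mathbf s\to\mathbf s')$ is the sum of $F(\tau)$ over complete trajectories $\tau$ that use the edge $\mathbf s\to\mathbf s'$. A backward policy of $F$ is a family of probability distributions $P_B(\cdot\mid\mathbf s')$ over the parents of each non-initial state $\mathbf s'$ such that $F(\mathbf s\to\mathbf s')=F(\mathbf s')P_B(\mathbf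 s\mid\mathbf s')$ for every edge $\mathbf s\to\mathbf s'$ (so $P_B(\mathbf s\mid\mathbf s')=F(\mathbf s\to\mathbf s')/F(\mathbf s')$ whenever $F(\mathbf s')>0$). **Back-and-forth proposal.** A $K$-step back-and-forth trajectory from $\mathbf x$ to $\mathbf x'$ is a pair $(\tau,\tau')$ of directed paths in $G$ with $K$ edges each and with a common starting state: $\tau$ consists of the states $\mathbf s_{D-K},\mathbf s_{D-K+1},\dots,\mathbf s_D=\mathbf x$ (with edges $\mathbf s_t\to\mathbf s_{t+1}$), and $\tau'$ consists of the states $\mathbf s'_{D-K}=\mathbf s_{D-K},\mathbf s'_{D-K+1},\dots,\mathbf s'_D=\mathbf x'$ (with edges $\mathbf s'_t\to\mathbf s'_{t+1}$). Here $\tau$ is sampled backward from $\mathbf x$ using $P_B$, and then $\tau'$ is sampled forward from $\mathbf s_{D-K}$ using $P_F$. Write $$P_F(\tau)=\prod_{t=D-K}^{D-1}P_F(\mathbf s_{t+1}\mid\mathbf s_t),\qquad P_B(\tau\mid\mathbf x)=\prod_{t=D-K}^{D-1}P_B(\mathbf s_t\mid\mathbf s_{t+1}),$$ and similarly $P_F(\tau')$ and $P_B(\tau'\mid\mathbf x')$ using the states $\mathbf s'_t$. The proposal probability of moving from $\mathbf x$ to $\mathbf x'$ along $(\tau,\tau')$ is $P_B(\tau\mid\mathbf x)P_F(\tau')$, and that of the reversed move from $\mathbf x'$ to $\mathbf x$ is $P_B(\tau'\mid\mathbf x')P_F(\tau)$. The Metropolis–Hastings acceptance probability is $$A_{\tau,\tau'}(\mathbf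 x\to\mathbf x')=\min\left[1,\ \frac{e^{-\mathcal E(\mathbf x')}}{e^{-\mathcal E(\mathbf x)}}\cdot\frac{P_B(\tau'\mid\mathbf x')P_F(\tau)}{P_B(\tau\mid\mathbf x)P_F(\tau')}\right].$$ *)

theory Defs
  imports Complex_Main
begin

text \<open>A state in \<open>{0, 1, \<oslash>}\<^sup>D\<close> is a list of length \<open>D\<close>: \<open>None\<close> is the unspecified entry \<open>\<oslash>\<close>, and
  \<open>Some False\<close>, \<open>Some True\<close> are the bits \<open>0\<close>, \<open>1\<close>.\<close>

type_synonym state = "bool option list"

definition states :: "nat \<Rightarrow> state set" where
  "states D = {s. length s = D}"

definition initial_state :: "nat \<Rightarrow> state" where
  "initial_state D = replicate D None"

definition terminal_states :: "nat \<Rightarrow> state set" where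
  "terminal_states D = {s \<in> states D. None \<notin> set s}"

definition edge :: "nat \<Rightarrow> state \<Rightarrow> state \<Rightarrow> bool" where
  "edge D s s' \<longleftrightarrow> s \<in> states D \<and> s' \<in> states D \<and>
     (\<exists>i<D. \<exists>b. s ! i = None \<and> s' = s[i := Some b])"

definition children :: "nat \<Rightarrow> state \<Rightarrow> state set" where
  "children D s = {s'. edge D s s'}"

definition parents :: "nat \<Rightarrow> state \<Rightarrow> state set" where
  "parents D s' = {s. edge D s s'}"

text \<open>A directed path is the nonempty list of the states it visits, so a path with \<open>K\<close> edges has
  length \<open>K + 1\<close>.\<close>

definition dag_path :: "nat \<Rightarrow> state list \<Rightarrow> bool" where
  "dag_path D p \<longleftrightarrow> p \<noteq> [] \<and> set p \<subseteq> states D \<and> successively (edge D) p"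

definition complete_trajectories :: "nat \<Rightarrow> state list set" where
  "complete_trajectories D =
     {\<tau>. dag_path D \<tau> \<and> hd \<tau> = initial_state D \<and> last \<tau> \<in> terminal_states D}"

definition prob_dist_on :: "'a set \<Rightarrow> ('a \<Rightarrow> real) \<Rightarrow> bool" where
  "prob_dist_on A p \<longleftrightarrow> (\<forall>a\<in>A. 0 \<le> p a) \<and> (\<Sum>a\<in>A. p a) = 1"

text \<open>In policies the conditioning state is the first argument: \<open>PF s s'\<close> is \<open>P\<^sub>F(s' | s)\<close> and
  \<open>PB s' s\<close> is \<open>P\<^sub>B(s | s')\<close>.\<close>

type_synonym policy = "state \<Rightarrow> state \<Rightarrow> real"

definition forward_prob :: "policy \<Rightarrow> state list \<Rightarrow> real" where
  "forward_prob PF p = (\<Prod>t<length p - 1. PF (p ! t) (p ! Suc t))"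

definition backward_prob :: "policy \<Rightarrow> state list \<Rightarrow> real" where
  "backward_prob PB p = (\<Prod>t<length p - 1. PB (p ! Suc t) (p ! t))"

text \<open>Only the values of a flow on complete trajectories are ever used.\<close>

definition trajectory_flow :: "nat \<Rightarrow> (state list \<Rightarrow> real) \<Rightarrow> bool" where
  "trajectory_flow D F \<longleftrightarrow> (\<forall>\<tau>\<in>complete_trajectories D. 0 \<le> F \<tau>)"

definition forward_policy_of :: "nat \<Rightarrow> (state list \<Rightarrow> real) \<Rightarrow> policy \<Rightarrow> bool" where
  "forward_policy_of D F PF \<longleftrightarrow>
     (\<forall>s \<in> states D - terminal_states D. prob_dist_on (children D s) (PF s)) \<and>
     (\<exists>Z>0. \<forall>\<tau>\<in>complete_trajectories D. F \<tau> / Z = forward_prob PF \<tau>)"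

definition markovian_flow :: "nat \<Rightarrow> (state list \<Rightarrow> real) \<Rightarrow> bool" where
  "markovian_flow D F \<longleftrightarrow> trajectory_flow D F \<and> (\<exists>PF. forward_policy_of D F PF)"

definition state_flow :: "nat \<Rightarrow> (state list \<Rightarrow> real) \<Rightarrow> state \<Rightarrow> real" where
  "state_flow D F s = (\<Sum>\<tau> | \<tau> \<in> complete_trajectories D \<and> s \<in> set \<tau>. F \<tau>)"

definition edge_flow :: "nat \<Rightarrow> (state list \<Rightarrow> real) \<Rightarrow> state \<Rightarrow> state \<Rightarrow> real" where
  "edge_flow D F s s' =
     (\<Sum>\<tau> | \<tau> \<in> complete_trajectories D \<and> (\<exists>t. Suc t < length \<tau> \<and> \<tau> ! t = s \<and> \<tau> ! Suc t = s'). F \<tau>)"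

definition backward_policy_of :: "nat \<Rightarrow> (state list \<Rightarrow> real) \<Rightarrow> policy \<Rightarrow> bool" where
  "backward_policy_of D F PB \<longleftrightarrow>
     (\<forall>s' \<in> states D - {initial_state D}. prob_dist_on (parents D s') (PB s')) \<and>
     (\<forall>s s'. edge D s s' \<longrightarrow> edge_flow D F s s' = state_flow D F s' * PB s' s)"

definition reward :: "(state \<Rightarrow> real) \<Rightarrow> state \<Rightarrow> real" where
  "reward \<E> x = exp (- \<E> x)"

definition reward_matching :: "nat \<Rightarrow> (state list \<Rightarrow> real) \<Rightarrow> (state \<Rightarrow> real) \<Rightarrow> bool" where
  "reward_matching D F R \<longleftrightarrow>
     (\<forall>x\<in>terminal_states D. R x = (\<Sum>\<tau> | \<tau> \<in> complete_trajectories D \<and> last \<tau> = x. F \<tau>))"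

definition back_and_forth ::
    "nat \<Rightarrow> nat \<Rightarrow> state \<Rightarrow> state \<Rightarrow> state list \<Rightarrow> state list \<Rightarrow> bool" where
  "back_and_forth D K x x' \<tau> \<tau>' \<longleftrightarrow>
     dag_path D \<tau> \<and> length \<tau> = K + 1 \<and> last \<tau> = x \<and>
     dag_path D \<tau>' \<and> length \<tau>' = K + 1 \<and> last \<tau>' = x' \<and>
     hd \<tau> = hd \<tau>'"

definition proposal_prob :: "policy \<Rightarrow> policy \<Rightarrow> state list \<Rightarrow> state list \<Rightarrow> real" where
  "proposal_prob PF PB \<tau> \<tau>' = backward_prob PB \<tau> * forward_prob PF \<tau>'"

definition acceptance_prob ::
    "(state \<Rightarrow> real) \<Rightarrow> policy \<Rightarrow> policy \<Rightarrow> state list \<Rightarrow> state list \<Rightarrow> state \<Rightarrow> state \<Rightarrow> real" where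
  "acceptance_prob \<E> PF PB \<tau> \<tau>' x x' =
     min 1 (exp (- \<E> x') / exp (- \<E> x) * (proposal_prob PF PB \<tau>' \<tau> / proposal_prob PF PB \<tau> \<tau>'))"

text \<open>All index sets of the sums above are finite, and complete trajectories have exactly \<open>D\<close>
  edges.\<close>

lemma finite_states: "finite (states D)"
  using finite_lists_length_eq[of "UNIV :: bool option set" D] by (simp add: states_def)

lemma terminal_iff_no_children:
  assumes "s \<in> states D"
  shows "s \<in> terminal_states D \<longleftrightarrow> children D s = {}"
proof
  assume s: "s \<in> terminal_states D"
  have "\<not> edge D s s'" for s'
  proof
    assume "edge D s s'"
    then obtain i where "i < length s" "s ! i = None"
      by (auto simp: edge_def states_def)
    then have "None \<in> set s" by (metis nth_mem)
    with s show False by (simp add: terminal_states_def)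
  qed
  then show "children D s = {}" by (simp add: children_def)
next
  assume no_child: "children D s = {}"
  have "None \<notin> set s"
  proof
    assume "None \<in> set s"
    then obtain i where "i < length s" "s ! i = None" by (metis in_set_conv_nth)
    then have "edge D s (s[i := Some True])"
      unfolding edge_def using assms by (auto simp: states_def)
    with no_child show False by (simp add: children_def)
  qed
  with assms show "s \<in> terminal_states D" by (simp add: terminal_states_def)
qed

lemma edge_count_None:
  assumes "edge D s s'"
  shows "count_list s None = Suc (count_list s' None)"
proof -
  obtain i b where i: "i < length s" "s ! i = None" and s': "s' = s[i := Some b]"
    using assms by (auto simp: edge_def states_def)
  have "s = take i s @ None # drop (Suc i) s" using i by (metis id_take_nth_drop)
  then have "count_list s None = count_list (take i s @ None # drop (Suc i) s) None"
    by (rule arg_cong)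
  then show ?thesis using i by (simp add: s' upd_conv_take_nth_drop)
qed

lemma path_count_None:
  assumes "successively (edge D) p" "p \<noteq> []"
  shows "count_list (hd p) None + 1 = count_list (last p) None + length p"
  using assms
proof (induction p)
  case (Cons s p)
  show ?case
  proof (cases p)
    case Nil
    then show ?thesis by simp
  next
    case p: (Cons s' q)
    have "edge D s s'" and "successively (edge D) p"
      using Cons.prems(1) by (simp_all add: p)
    then show ?thesis
      using Cons.IH edge_count_None[of D s s'] by (simp add: p)
  qed
qed simp

lemma length_complete_trajectory:
  assumes "\<tau> \<in> complete_trajectories D"
  shows "length \<tau> = D + 1"
proof -
  have "count_list (replicate D (None :: bool option)) None = D" by (induction D) auto
  moreover have "count_list (last \<tau>) None = 0"
    using assms by (simp add: complete_trajectories_def terminal_states_def count_list_0_iff)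
  ultimately show ?thesis
    using assms path_count_None[of D \<tau>]
    by (auto simp: complete_trajectories_def dag_path_def initial_state_def)
qed

lemma finite_complete_trajectories: "finite (complete_trajectories D)"
proof (rule finite_subset)
  show "complete_trajectories D \<subseteq> {p. set p \<subseteq> states D \<and> length p = D + 1}"
    using length_complete_trajectory by (auto simp: complete_trajectories_def dag_path_def)
  show "finite {p. set p \<subseteq> states D \<and> length p = D + 1}"
    using finite_states by (rule finite_lists_length_eq)
qed

end

theory Submission
  imports Defs
begin

text \<open>For a Markovian flow the total forward probability of the paths from a state \<open>s\<close> to the
  terminal states is 1. Splitting complete trajectories at \<open>s\<close>, or at an edge \<open>s \<rightarrow> s'\<close>, therefore
  gives \<open>F(s \<rightarrow> s') = F(s) P\<^sub>F(s' | s)\<close>. Together with \<open>F(s \<rightarrow> s') = F(s') P\<^sub>B(s | s')\<close> this is detailed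
  balance along edges, which telescopes to \<open>F(s) P\<^sub>F(\<tau>) = F(x) P\<^sub>B(\<tau> | x)\<close> for a path \<open>\<tau>\<close> from \<open>s\<close> to
  \<open>x\<close>. As \<open>F(x) = R(x)\<close> for terminal \<open>x\<close>, the Metropolis--Hastings ratio of two paths with a common
  starting state is 1.\<close>

text \<open>The state \<open>s\<close> is kept out of both prefixes and continuations, so that a
  trajectory through \<open>s\<close> reads \<open>p @ s # q\<close>. Taking the head of
  \<open>p @ [s]\<close> covers the empty prefix, which occurs when \<open>s\<close> is the initial
  state.\<close>

definition prefixes_to :: "nat \<Rightarrow> state \<Rightarrow> state list set" where
  "prefixes_to D s = {p. dag_path D (p @ [s]) \<and> hd (p @ [s]) = initial_state D}"

definition continuations :: "nat \<Rightarrow> state \<Rightarrow> state list set" where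
  "continuations D s = {q. dag_path D (s # q) \<and> last (s # q) \<in> terminal_states D}"

lemma forward_prob_singleton [simp]: "forward_prob PF [s] = 1"
  by (simp add: forward_prob_def)

lemma forward_prob_Cons_Cons [simp]:
  "forward_prob PF (s # s' # q) = PF s s' * forward_prob PF (s' # q)"
  by (simp add: forward_prob_def prod.lessThan_Suc_shift del: prod.lessThan_Suc)

lemma backward_prob_singleton [simp]: "backward_prob PB [s] = 1"
  by (simp add: backward_prob_def)

lemma backward_prob_Cons_Cons [simp]:
  "backward_prob PB (s # s' # q) = PB s' s * backward_prob PB (s' # q)"
  by (simp add: backward_prob_def prod.lessThan_Suc_shift del: prod.lessThan_Suc)

text \<open>Both factors contain \<open>s\<close>, since the products run over edges: cutting at a
  shared state loses no edge.\<close>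

lemma forward_prob_split:
  "forward_prob PF (p @ s # q) = forward_prob PF (p @ [s]) * forward_prob PF (s # q)"
proof (induction p)
  case (Cons a p)
  then show ?case by (cases p) auto
qed simp

lemma dag_path_singleton [simp]: "dag_path D [s] \<longleftrightarrow> s \<in> states D"
  by (simp add: dag_path_def)

lemma dag_path_Cons_Cons [simp]:
  "dag_path D (s # s' # q) \<longleftrightarrow> edge D s s' \<and> dag_path D (s' # q)"
  by (auto simp: dag_path_def edge_def)

lemma dag_path_split:
  "dag_path D (p @ s # q) \<longleftrightarrow> dag_path D (p @ [s]) \<and> dag_path D (s # q)"
  by (auto simp: dag_path_def successively_append_iff)

text \<open>The condition on the start concerns only \<open>p @ [s]\<close>, the one on the end only
  \<open>s # q\<close>. Hence sums over trajectories through \<open>s\<close> become sums over a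
  product set.\<close>

lemma complete_trajectory_split:
  "p @ s # q \<in> complete_trajectories D \<longleftrightarrow> p \<in> prefixes_to D s \<and> q \<in> continuations D s"
proof -
  have "hd (p @ s # q) = hd (p @ [s])"
    by (cases p) auto
  then show ?thesis
    unfolding complete_trajectories_def prefixes_to_def continuations_def
    using dag_path_split[of D p s q] by auto
qed

lemma continuations_terminal:
  assumes "s \<in> terminal_states D"
  shows "continuations D s = {[]}"
proof -
  have s: "s \<in> states D" using assms by (simp add: terminal_states_def)
  then have "\<not> edge D s s'" for s'
    using assms terminal_iff_no_children[of s D] by (auto simp: children_def)
  then have "q \<in> continuations D s \<longleftrightarrow> q = []" for q
    using s assms by (cases q) (auto simp: continuations_def)
  then show ?thesis by blast
qed

lemma continuations_nonterminal:
  assumes "s \<notin> terminal_states D"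
  shows "continuations D s = (\<lambda>(s', q). s' # q) ` (SIGMA s':children D s. continuations D s')"
proof (intro set_eqI iffI)
  fix q assume "q \<in> continuations D s"
  with assms show "q \<in> (\<lambda>(s', q). s' # q) ` (SIGMA s':children D s. continuations D s')"
    by (cases q) (auto simp: continuations_def children_def image_iff)
qed (auto simp: continuations_def children_def)

lemma length_continuation:
  assumes "q \<in> continuations D s"
  shows "length q = count_list s None"
proof -
  have "count_list (last (s # q)) None = 0"
    using assms by (simp add: continuations_def terminal_states_def count_list_0_iff)
  then show ?thesis
    using assms path_count_None[of D "s # q"]
    by (simp add: continuations_def dag_path_def del: last.simps)
qed

lemma finite_continuations: "finite (continuations D s)"
proof (rule finite_subset)
  show "continuations D s \<subseteq> {q. set q \<subseteq> states D \<and> length q = count_list s None}"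
    by (auto simp: length_continuation) (auto simp: continuations_def dag_path_def)
qed (simp add: finite_lists_length_eq finite_states)

lemma finite_children: "finite (children D s)"
  by (rule finite_subset[OF _ finite_states[of D]]) (auto simp: children_def edge_def)

text \<open>Induction on the number of unspecified entries, which every edge lowers by one. A
  terminal state has only the empty continuation, with empty product 1; otherwise grouping by the
  first step leaves the sum of \<open>PF s\<close> over the children.\<close>

lemma sum_forward_prob_continuations:
  assumes PF: "forward_policy_of D F PF" and s: "s \<in> states D"
  shows "(\<Sum>q\<in>continuations D s. forward_prob PF (s # q)) = 1"
  using s
proof (induction "count_list s None" arbitrary: s rule: less_induct)
  case less
  show ?case
  proof (cases "s \<in> terminal_states D")
    case True
    then show ?thesis by (simp add: continuations_terminal)
  next
    case False
    have IH: "(\<Sum>q\<in>continuations D s'. forward_prob PF (s' # q)) = 1" if "s' \<in> children D s" for s'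
      using that less.hyps[of s'] edge_count_None[of D s s'] by (auto simp: children_def edge_def)
    have "(\<Sum>q\<in>continuations D s. forward_prob PF (s # q))
        = (\<Sum>(s', q)\<in>(SIGMA s':children D s. continuations D s'). PF s s' * forward_prob PF (s' # q))"
      unfolding continuations_nonterminal[OF False]
      by (subst sum.reindex) (auto simp: inj_on_def case_prod_beta)
    also have "\<dots> = (\<Sum>s'\<in>children D s. \<Sum>q\<in>continuations D s'. PF s s' * forward_prob PF (s' # q))"
      by (rule sum.Sigma[symmetric]) (auto simp: finite_children finite_continuations)
    also have "\<dots> = (\<Sum>s'\<in>children D s. PF s s')"
      using IH by (simp flip: sum_distrib_left)
    also have "\<dots> = 1"
      using PF False less.prems by (simp add: forward_policy_of_def prob_dist_on_def)
    finally show ?thesis .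
  qed
qed

text \<open>The number of unspecified entries of \<open>s\<close> fixes the position at which a path from the initial
  state visits \<open>s\<close>.\<close>

lemma prefixes_to_same_length:
  assumes "p \<in> prefixes_to D s" "p' \<in> prefixes_to D s"
  shows "length p = length p'"
  using assms path_count_None[of D "p @ [s]"] path_count_None[of D "p' @ [s]"]
  by (simp add: prefixes_to_def dag_path_def)

text \<open>Equal prefix lengths make the cut at \<open>s\<close> unique. The list \<open>r\<close>
  is \<open>[]\<close> for trajectories through a state and \<open>[s']\<close> for those through an
  edge.\<close>

lemma inj_on_prefixes_to: "inj_on (\<lambda>(p, q). p @ s # r @ q) (prefixes_to D s \<times> B)"
  by (auto simp: inj_on_def dest: prefixes_to_same_length)

lemma state_trajectories:
  "{\<tau>. \<tau> \<in> complete_trajectories D \<and> s \<in> set \<tau>}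
     = (\<lambda>(p, q). p @ s # q) ` (prefixes_to D s \<times> continuations D s)"
proof (intro set_eqI iffI)
  fix \<tau> assume "\<tau> \<in> {\<tau>. \<tau> \<in> complete_trajectories D \<and> s \<in> set \<tau>}"
  moreover from this obtain p q where "\<tau> = p @ s # q"
    by (auto dest: split_list)
  ultimately show "\<tau> \<in> (\<lambda>(p, q). p @ s # q) ` (prefixes_to D s \<times> continuations D s)"
    by (auto simp: complete_trajectory_split)
qed (auto simp: complete_trajectory_split)

lemma edge_trajectories:
  assumes "edge D s s'"
  shows "{\<tau>. \<tau> \<in> complete_trajectories D \<and> (\<exists>t. Suc t < length \<tau> \<and> \<tau> ! t = s \<and> \<tau> ! Suc t = s')}
     = (\<lambda>(p, q). p @ s # s' # q) ` (prefixes_to D s \<times> continuations D s')"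
    (is "?L = ?R")
proof (intro set_eqI iffI)
  fix \<tau> assume \<tau>: "\<tau> \<in> ?L"
  then obtain t where t: "Suc t < length \<tau>" "\<tau> ! t = s" "\<tau> ! Suc t = s'"
    by blast
  then have split: "\<tau> = take t \<tau> @ s # s' # drop (Suc (Suc t)) \<tau>"
    by (metis Cons_nth_drop_Suc Suc_lessD append_take_drop_id)
  with \<tau> have "take t \<tau> @ s # s' # drop (Suc (Suc t)) \<tau> \<in> complete_trajectories D"
    by simp
  then have "(take t \<tau>, drop (Suc (Suc t)) \<tau>) \<in> prefixes_to D s \<times> continuations D s'"
    by (auto simp: complete_trajectory_split continuations_def)
  with split show "\<tau> \<in> ?R"
    by (metis (no_types, lifting) case_prod_conv image_eqI)
next
  fix \<tau> assume "\<tau> \<in> ?R"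
  then obtain p q where pq: "\<tau> = p @ s # s' # q" "p \<in> prefixes_to D s" "q \<in> continuations D s'"
    by auto
  then have "\<tau> \<in> complete_trajectories D"
    using assms by (auto simp: complete_trajectory_split continuations_def)
  moreover have "Suc (length p) < length \<tau> \<and> \<tau> ! length p = s \<and> \<tau> ! Suc (length p) = s'"
    by (simp add: pq nth_append)
  ultimately show "\<tau> \<in> ?L" by blast
qed

text \<open>Both flows sum over the same prefixes, and the continuations, from \<open>s\<close> or
  from \<open>s'\<close>, contribute total probability 1. Only the factor \<open>PF s s'\<close> of
  the edge itself remains. No division by a flow occurs, so states of zero flow are covered.\<close>

lemma edge_flow_forward:
  assumes PF: "forward_policy_of D F PF" and e: "edge D s s'"
  shows "edge_flow D F s s' = state_flow D F s * PF s s'"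
proof -
  obtain Z where "Z > 0" and Z: "\<And>\<tau>. \<tau> \<in> complete_trajectories D \<Longrightarrow> F \<tau> / Z = forward_prob PF \<tau>"
    using PF by (auto simp: forward_policy_of_def)
  then have F: "F \<tau> = Z * forward_prob PF \<tau>" if "\<tau> \<in> complete_trajectories D" for \<tau>
    using Z[OF that] by (simp add: field_simps)
  \<comment> \<open>The total forward probability of reaching \<open>s\<close>, common to both
    computations below.\<close>
  define P where "P = (\<Sum>p\<in>prefixes_to D s. forward_prob PF (p @ [s]))"
  have total: "(\<Sum>q\<in>continuations D u. forward_prob PF (u # q)) = 1" if "u \<in> {s, s'}" for u
    using that e sum_forward_prob_continuations[OF PF] by (auto simp: edge_def)

  have "state_flow D F s = (\<Sum>\<tau> | \<tau> \<in> complete_trajectories D \<and> s \<in> set \<tau>. Z * forward_prob PF \<tau>)"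
    unfolding state_flow_def by (rule sum.cong) (auto simp: F)
  also have "\<dots> = (\<Sum>(p, q)\<in>prefixes_to D s \<times> continuations D s.
      Z * (forward_prob PF (p @ [s]) * forward_prob PF (s # q)))"
    unfolding state_trajectories using inj_on_prefixes_to[of s "[]" D]
    by (subst sum.reindex) (auto simp: case_prod_beta intro!: sum.cong forward_prob_split)
  also have "\<dots> = Z * P"
    using total[of s]
    by (simp add: P_def flip: sum.cartesian_product sum_distrib_left sum_distrib_right)
  finally have state: "state_flow D F s = Z * P" .

  have "edge_flow D F s s'
      = (\<Sum>\<tau> | \<tau> \<in> complete_trajectories D \<and>
           (\<exists>t. Suc t < length \<tau> \<and> \<tau> ! t = s \<and> \<tau> ! Suc t = s'). Z * forward_prob PF \<tau>)"
    unfolding edge_flow_def by (rule sum.cong) (auto simp: F)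
  also have "\<dots> = (\<Sum>(p, q)\<in>prefixes_to D s \<times> continuations D s'.
      Z * (forward_prob PF (p @ [s]) * (PF s s' * forward_prob PF (s' # q))))"
    unfolding edge_trajectories[OF e] using inj_on_prefixes_to[of s "[s']" D]
    by (subst sum.reindex) (auto simp: case_prod_beta intro!: sum.cong forward_prob_split[of PF _ s "s' # _", simplified])
  also have "\<dots> = Z * P * PF s s'"
    using total[of s']
    by (simp add: P_def flip: sum.cartesian_product sum_distrib_left sum_distrib_right)
  finally show ?thesis by (simp add: state)
qed

text \<open>Induction along the path, peeling off the first edge; for a single state both products
  are empty.\<close>

lemma path_balance:
  assumes "forward_policy_of D F PF" "backward_policy_of D F PB" "dag_path D p"
  shows "state_flow D F (hd p) * forward_prob PF p = state_flow D F (last p) * backward_prob PB p"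
  using assms(3)
proof (induction p rule: induct_list012)
  case (3 s s' q)
  then have e: "edge D s s'" and q: "dag_path D (s' # q)" by auto
  \<comment> \<open>Equating the two expressions for the edge flow trades a forward step for a
    backward one and moves the flow factor from \<open>s\<close> to \<open>s'\<close>.\<close>
  have edge: "state_flow D F s * PF s s' = state_flow D F s' * PB s' s"
    using edge_flow_forward[OF assms(1) e] assms(2) e by (simp add: backward_policy_of_def)
  have "state_flow D F s * forward_prob PF (s # s' # q)
      = PB s' s * (state_flow D F s' * forward_prob PF (s' # q))"
    using edge by (simp add: mult.assoc[symmetric])
  also have "\<dots> = PB s' s * (state_flow D F (last (s' # q)) * backward_prob PB (s' # q))"
    using "3.IH"(2) q by simp
  finally show ?case by simp
qed (simp_all add: dag_path_def)

text \<open>Nothing can follow a terminal state, so a trajectory that visits \<open>x\<close> ends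
  there, and the state flow is the sum in the reward matching condition.\<close>

lemma state_flow_terminal:
  assumes "reward_matching D F R" "x \<in> terminal_states D"
  shows "state_flow D F x = R x"
proof -
  have "last \<tau> = x \<longleftrightarrow> x \<in> set \<tau>" if "\<tau> \<in> complete_trajectories D" for \<tau>
  proof
    assume "last \<tau> = x"
    with that show "x \<in> set \<tau>" by (auto simp: complete_trajectories_def dag_path_def)
  next
    assume "x \<in> set \<tau>"
    then obtain p q where "\<tau> = p @ x # q" by (auto dest: split_list)
    with that show "last \<tau> = x"
      by (simp add: complete_trajectory_split continuations_terminal[OF assms(2)])
  qed
  then have "{\<tau>. \<tau> \<in> complete_trajectories D \<and> x \<in> set \<tau>}
      = {\<tau>. \<tau> \<in> complete_trajectories D \<and> last \<tau> = x}" by blast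
  then show ?thesis
    using assms by (simp add: state_flow_def reward_matching_def)
qed

theorem proposition2:
  fixes D K :: nat
    and \<E> :: "state \<Rightarrow> real"
    and F :: "state list \<Rightarrow> real"
    and PF PB :: policy
    and x x' :: state
    and \<tau> \<tau>' :: "state list"
  assumes "D \<ge> 1"
    and "markovian_flow D F"
    and "forward_policy_of D F PF"
    and "backward_policy_of D F PB"
    and "reward_matching D F (reward \<E>)"
    and "1 \<le> K" and "K \<le> D"
    and "x \<in> terminal_states D" and "x' \<in> terminal_states D"
    and "back_and_forth D K x x' \<tau> \<tau>'"
    and "proposal_prob PF PB \<tau> \<tau>' > 0"
  shows "acceptance_prob \<E> PF PB \<tau> \<tau>' x x' = 1"
proof -
  have path: "dag_path D \<tau>" "last \<tau> = x" "dag_path D \<tau>'" "last \<tau>' = x'" "hd \<tau>' = hd \<tau>"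
    using assms(10) by (auto simp: back_and_forth_def)
  have flow: "state_flow D F y = exp (- \<E> y)" if "y \<in> terminal_states D" for y
    using state_flow_terminal[OF assms(5) that] by (simp add: reward_def)
  have b: "exp (- \<E> x) * backward_prob PB \<tau> = state_flow D F (hd \<tau>) * forward_prob PF \<tau>"
    using path_balance[OF assms(3,4) path(1)] flow[OF assms(8)] path(2) by simp
  have b': "exp (- \<E> x') * backward_prob PB \<tau>' = state_flow D F (hd \<tau>) * forward_prob PF \<tau>'"
    using path_balance[OF assms(3,4) path(3)] flow[OF assms(9)] path(4,5) by simp
  \<comment> \<open>By \<open>b\<close> and \<open>b'\<close> both sides equal the flow at the
    common start times the forward probabilities of \<open>\<tau>\<close> and
    \<open>\<tau>'\<close>.\<close>
  have "exp (- \<E> x') * proposal_prob PF PB \<tau>' \<tau> = exp (- \<E> x) * proposal_prob PF PB \<tau> \<tau>'"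
    unfolding proposal_prob_def mult.assoc[symmetric] b b' by (simp add: mult_ac)
  \<comment> \<open>Positivity of the proposal enters here: with a zero denominator the quotient
    would be 0 by convention instead of 1.\<close>
  moreover have "exp (- \<E> x) * proposal_prob PF PB \<tau> \<tau>' \<noteq> 0"
    using assms(11) by simp
  ultimately have "exp (- \<E> x') / exp (- \<E> x) *
      (proposal_prob PF PB \<tau>' \<tau> / proposal_prob PF PB \<tau> \<tau>') = 1"
    by (metis divide_self times_divide_times_eq)
  then show ?thesis unfolding acceptance_prob_def by (simp only: min.idem)
qed

end
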